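(* There is a one-to-one correspondence between $n\times 2n$ half grid diagrams and elements in the symmetric group $\mathrm{Sym}(2n)$.
   Context: Here $n$ is a positive integer and $\mathrm{Sym}(2n)$ is the group of permutations of $\{1,2,\dots,2n\}$. An $n\times 2n$ half grid diagram is an $n\times 2n$ grid ($n$ rows, $2n$ columns) of squares, each of which is either empty or contains an $X$ or an $O$, such that in each row there are exactly two nonempty squares, one containing an $X$ and the other containing an $O$, and each column has exactly one nonempty square (which may contain either an $X$ or an $O$). *)

theory Defs
  imports "HOL-Algebra.Sym_Groups" "HOL-Library.FuncSet"
begin

datatype square = Empty | X_mark | O_mark

text \<open>A filling of the grid assigns a content to each square \<open>(i, j)\<close> (row \<open>i\<close>, column \<open>j\<close>).
  It is extensional, so that distinct functions are distinct diagrams.\<close>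

definition half_grid_diagrams :: "nat \<Rightarrow> (nat \<times> nat \<Rightarrow> square) set" where
  "half_grid_diagrams n =
    {D \<in> {1..n} \<times> {1..2 * n} \<rightarrow>\<^sub>E UNIV.
      (\<forall>i\<in>{1..n}. card {j \<in> {1..2 * n}. D (i, j) \<noteq> Empty} = 2 \<and>
         (\<exists>j\<in>{1..2 * n}. D (i, j) = X_mark) \<and> (\<exists>j\<in>{1..2 * n}. D (i, j) = O_mark)) \<and>
      (\<forall>j\<in>{1..2 * n}. \<exists>!i. i \<in> {1..n} \<and> D (i, j) \<noteq> Empty)}"

end

theory Submission imports Defs begin

text \<open>A permutation \<open>p\<close> of \<open>{1..2 * n}\<close> is read as the list of columns of the marks, row by row:
  row \<open>i\<close> has its X in column \<open>p (2 * i - 1)\<close> and its O in column \<open>p (2 * i)\<close>. That each column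
  has exactly one mark is precisely the bijectivity of \<open>p\<close>.\<close>

definition diagram_of_perm :: "nat \<Rightarrow> (nat \<Rightarrow> nat) \<Rightarrow> nat \<times> nat \<Rightarrow> square" where
  "diagram_of_perm n p =
    (\<lambda>(i, j) \<in> {1..n} \<times> {1..2 * n}.
      if j = p (2 * i - 1) then X_mark else if j = p (2 * i) then O_mark else Empty)"

lemma diagram_of_perm_apply:
  assumes "i \<in> {1..n}" "j \<in> {1..2 * n}"
  shows "diagram_of_perm n p (i, j) =
    (if j = p (2 * i - 1) then X_mark else if j = p (2 * i) then O_mark else Empty)"
  using assms by (simp add: diagram_of_perm_def)

lemma double_index_cases:
  fixes k n :: nat
  assumes "k \<in> {1..2 * n}"
  obtains i where "i \<in> {1..n}" "k = 2 * i - 1" | i where "i \<in> {1..n}" "k = 2 * i"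
proof (cases "even k")
  case True
  then obtain i where "k = 2 * i" by blast
  with assms that(2)[of i] show ?thesis by auto
next
  case False
  then obtain i where "k = 2 * i + 1" by (blast elim: oddE)
  with assms that(1)[of "i + 1"] show ?thesis by auto
qed

text \<open>Injectivity of \<open>p\<close> keeps the two marks of a row apart. This matters because
  \<open>diagram_of_perm\<close> tests for X first: if the two columns coincided, the O would be
  lost.\<close>

lemma permutes_double_index:
  fixes n :: nat
  assumes "p permutes {1..2 * n}" "i \<in> {1..n}"
  shows "p (2 * i - 1) \<in> {1..2 * n}" "p (2 * i) \<in> {1..2 * n}" "p (2 * i - 1) \<noteq> p (2 * i)"
proof -
  have "2 * i - 1 \<in> {1..2 * n}" "2 * i \<in> {1..2 * n}" "2 * i - 1 \<noteq> 2 * i"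
    using assms(2) by auto
  then show "p (2 * i - 1) \<in> {1..2 * n}" "p (2 * i) \<in> {1..2 * n}" "p (2 * i - 1) \<noteq> p (2 * i)"
    by (simp_all only: permutes_in_image[OF assms(1)] inj_eq[OF permutes_inj[OF assms(1)]]
        not_False_eq_True)
qed

lemma diagram_of_perm_in_half_grid_diagrams:
  assumes p: "p permutes {1..2 * n}"
  shows "diagram_of_perm n p \<in> half_grid_diagrams n"
proof -
  let ?D = "diagram_of_perm n p"
  have row: "card {j \<in> {1..2 * n}. ?D (i, j) \<noteq> Empty} = 2 \<and>
      (\<exists>j\<in>{1..2 * n}. ?D (i, j) = X_mark) \<and> (\<exists>j\<in>{1..2 * n}. ?D (i, j) = O_mark)"
    if i: "i \<in> {1..n}" for i
  proof (intro conjI)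
    note pi = permutes_double_index[OF p i]
    have "{j \<in> {1..2 * n}. ?D (i, j) \<noteq> Empty} = {p (2 * i - 1), p (2 * i)}"
      using pi i by (auto simp: diagram_of_perm_apply split: if_splits)
    then show "card {j \<in> {1..2 * n}. ?D (i, j) \<noteq> Empty} = 2"
      using pi by simp
    have "?D (i, p (2 * i - 1)) = X_mark" "?D (i, p (2 * i)) = O_mark"
      using pi i by (auto simp: diagram_of_perm_apply)
    then show "\<exists>j\<in>{1..2 * n}. ?D (i, j) = X_mark" "\<exists>j\<in>{1..2 * n}. ?D (i, j) = O_mark"
      using pi by blast+
  qed
  have col: "\<exists>!i. i \<in> {1..n} \<and> ?D (i, j) \<noteq> Empty" if j: "j \<in> {1..2 * n}" for j
  proof -
    obtain k where k: "k \<in> {1..2 * n}" "j = p k"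
      using j permutes_image[OF p] by blast
    \<comment> \<open>\<open>Suc k div 2\<close> is k/2 rounded up, the common row of the indices
      \<open>2 * i - 1\<close> and \<open>2 * i\<close>. Surjectivity of \<open>p\<close> supplied
      \<open>k\<close>, hence a mark in column \<open>j\<close>; injectivity of \<open>p\<close>
      excludes a second one.\<close>
    have "?D (i, j) \<noteq> Empty \<longleftrightarrow> i = Suc k div 2" if i: "i \<in> {1..n}" for i
    proof -
      have "?D (i, j) \<noteq> Empty \<longleftrightarrow> k = 2 * i - 1 \<or> k = 2 * i"
        unfolding diagram_of_perm_apply[OF i j] unfolding k(2) inj_eq[OF permutes_inj[OF p]]
        by simp
      also have "\<dots> \<longleftrightarrow> i = Suc k div 2"
        using i by (cases i) auto
      finally show ?thesis .
    qed
    moreover have "Suc k div 2 \<in> {1..n}"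
      using k(1) by auto
    ultimately show ?thesis by blast
  qed
  have "?D \<in> {1..n} \<times> {1..2 * n} \<rightarrow>\<^sub>E UNIV"
    by (auto simp: diagram_of_perm_def)
  with row col show ?thesis
    unfolding half_grid_diagrams_def by simp
qed

text \<open>The X and the O of row \<open>i\<close> reveal \<open>p (2 * i - 1)\<close> and
  \<open>p (2 * i)\<close>, and these indices exhaust \<open>{1..2 * n}\<close>; elsewhere every
  such permutation is the identity.\<close>

lemma inj_on_diagram_of_perm: "inj_on (diagram_of_perm n) {p. p permutes {1..2 * n}}"
proof (rule inj_onI)
  fix p q
  assume "p \<in> {p. p permutes {1..2 * n}}" "q \<in> {p. p permutes {1..2 * n}}"
  then have p: "p permutes {1..2 * n}" and q: "q permutes {1..2 * n}" by auto
  assume eq: "diagram_of_perm n p = diagram_of_perm n q"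
  have same: "p (2 * i - 1) = q (2 * i - 1)" "p (2 * i) = q (2 * i)" if i: "i \<in> {1..n}" for i
  proof -
    note pi = permutes_double_index[OF p i]
    \<comment> \<open>These values are computed in the diagram of \<open>p\<close> and carried over
      by \<open>eq\<close>. Evaluating them next by the formula for \<open>q\<close> forces the
      columns to agree, since each kind of mark has only one possible column in a row.\<close>
    have "diagram_of_perm n q (i, p (2 * i - 1)) = X_mark"
      "diagram_of_perm n q (i, p (2 * i)) = O_mark"
      using pi i by (auto simp: diagram_of_perm_apply simp flip: eq)
    then show "p (2 * i - 1) = q (2 * i - 1)" "p (2 * i) = q (2 * i)"
      using pi i by (auto simp: diagram_of_perm_apply split: if_splits)
  qed
  show "p = q"
  proof
    fix k
    show "p k = q k"
    proof (cases "k \<in> {1..2 * n}")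
      case True
      then show ?thesis by (cases rule: double_index_cases) (use same in auto)
    next
      case False
      then show ?thesis using p q by (simp add: permutes_not_in)
    qed
  qed
qed

text \<open>Surjectivity: list the columns of the X and the O of each row in turn. No column is
  listed twice because its marked row is unique, and an injective self-map of a finite set is a
  bijection.\<close>

lemma half_grid_diagram_is_diagram_of_perm:
  assumes D: "D \<in> half_grid_diagrams n"
  obtains p where "p permutes {1..2 * n}" "diagram_of_perm n p = D"
proof -
  have ext: "D \<in> {1..n} \<times> {1..2 * n} \<rightarrow>\<^sub>E UNIV"
    and card_row: "\<And>i. i \<in> {1..n} \<Longrightarrow> card {j \<in> {1..2 * n}. D (i, j) \<noteq> Empty} = 2"
    and ex_X: "\<forall>i\<in>{1..n}. \<exists>j. j \<in> {1..2 * n} \<and> D (i, j) = X_mark"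
    and ex_O: "\<forall>i\<in>{1..n}. \<exists>j. j \<in> {1..2 * n} \<and> D (i, j) = O_mark"
    and col: "\<And>j. j \<in> {1..2 * n} \<Longrightarrow> \<exists>!i. i \<in> {1..n} \<and> D (i, j) \<noteq> Empty"
    using D unfolding half_grid_diagrams_def by blast+
  obtain x where x: "\<And>i. i \<in> {1..n} \<Longrightarrow> x i \<in> {1..2 * n} \<and> D (i, x i) = X_mark"
    using bchoice[OF ex_X] by blast
  obtain y where y: "\<And>i. i \<in> {1..n} \<Longrightarrow> y i \<in> {1..2 * n} \<and> D (i, y i) = O_mark"
    using bchoice[OF ex_O] by blast
  \<comment> \<open>An X and an O occupy different squares, so together they already account for the
    two nonempty squares of the row.\<close>
  have row: "{j \<in> {1..2 * n}. D (i, j) \<noteq> Empty} = {x i, y i}" if i: "i \<in> {1..n}" for i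
  proof (rule sym, rule card_subset_eq)
    show "{x i, y i} \<subseteq> {j \<in> {1..2 * n}. D (i, j) \<noteq> Empty}"
      using x[OF i] y[OF i] by auto
    have "x i \<noteq> y i" using x[OF i] y[OF i] by auto
    then show "card {x i, y i} = card {j \<in> {1..2 * n}. D (i, j) \<noteq> Empty}"
      using card_row[OF i] by simp
  qed simp
  have same_row: "i = i'"
    if "i \<in> {1..n}" "i' \<in> {1..n}" "j \<in> {1..2 * n}" "D (i, j) \<noteq> Empty" "D (i', j) \<noteq> Empty"
    for i i' j
    using that col by blast
  \<comment> \<open>Even indices list the O columns and odd indices the X columns. Off
    \<open>{1..2 * n}\<close> the value is \<open>k\<close> itself, as \<open>permutes\<close>
    demands.\<close>
  define p where "p k =
    (if k \<in> {1..2 * n} then if even k then y (k div 2) else x (Suc k div 2) else k)" for k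
  have p_odd: "p (2 * i - 1) = x i" and p_even: "p (2 * i) = y i" if "i \<in> {1..n}" for i
    using that by (auto simp: p_def)
  have "p ` {1..2 * n} \<subseteq> {1..2 * n}"
  proof (rule image_subsetI)
    fix k :: nat
    assume "k \<in> {1..2 * n}"
    then show "p k \<in> {1..2 * n}"
      by (cases rule: double_index_cases) (simp_all only: p_odd p_even x y)
  qed
  moreover have "inj_on p {1..2 * n}"
  proof (rule inj_onI)
    fix k l :: nat
    assume k: "k \<in> {1..2 * n}" and l: "l \<in> {1..2 * n}" and eq: "p k = p l"
    from k show "k = l"
    proof (cases rule: double_index_cases)
      case (1 i)
      note i = this
      from l show ?thesis
      proof (cases rule: double_index_cases)
        case (1 i')
        with i eq have "x i = x i'" by (simp only: p_odd)
        with x[OF i(1)] x[OF 1(1)] same_row[OF i(1) 1(1), of "x i"] i 1 show ?thesis by auto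
      next
        case (2 i')
        \<comment> \<open>If an X and an O shared a column, \<open>same_row\<close> would place both
          in one square, a contradiction.\<close>
        with i eq have "x i = y i'" by (simp only: p_odd p_even)
        with x[OF i(1)] y[OF 2(1)] same_row[OF i(1) 2(1), of "x i"] show ?thesis by auto
      qed
    next
      case (2 i)
      note i = this
      from l show ?thesis
      proof (cases rule: double_index_cases)
        case (1 i')
        with i eq have "y i = x i'" by (simp only: p_odd p_even)
        with y[OF i(1)] x[OF 1(1)] same_row[OF i(1) 1(1), of "y i"] show ?thesis by auto
      next
        case (2 i')
        with i eq have "y i = y i'" by (simp only: p_even)
        with y[OF i(1)] y[OF 2(1)] same_row[OF i(1) 2(1), of "y i"] i 2 show ?thesis by auto
      qed
    qed
  qed
  ultimately have "bij_betw p {1..2 * n} {1..2 * n}"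
    by (simp add: bij_betw_def endo_inj_surj)
  then have "p permutes {1..2 * n}"
    by (rule bij_imp_permutes) (simp only: p_def if_False)
  moreover have "diagram_of_perm n p = D"
  proof
    fix z :: "nat \<times> nat"
    obtain i j where z: "z = (i, j)" by (cases z)
    show "diagram_of_perm n p z = D z"
    proof (cases "z \<in> {1..n} \<times> {1..2 * n}")
      case True
      then have i: "i \<in> {1..n}" and j: "j \<in> {1..2 * n}" by (auto simp: z)
      \<comment> \<open>Where \<open>j\<close> is neither \<open>x i\<close> nor \<open>y i\<close>,
        both diagrams are empty; at these two columns the marks agree by the choice of
        \<open>x\<close> and \<open>y\<close>.\<close>
      have "j \<in> {x i, y i} \<longleftrightarrow> D (i, j) \<noteq> Empty"
        using row[OF i] j by blast
      with x[OF i] y[OF i] show ?thesis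
        unfolding z diagram_of_perm_apply[OF i j] p_odd[OF i] p_even[OF i] by auto
    next
      case False
      then show ?thesis
        \<comment> \<open>Outside the grid both functions are \<open>undefined\<close>, by
          extensionality.\<close>
        using PiE_arb[OF ext False] by (simp add: diagram_of_perm_def)
    qed
  qed
  ultimately show ?thesis by (rule that)
qed

lemma bij_betw_diagram_of_perm:
  "bij_betw (diagram_of_perm n) (carrier (sym_group (2 * n))) (half_grid_diagrams n)"
proof -
  have "diagram_of_perm n ` {p. p permutes {1..2 * n}} = half_grid_diagrams n"
    using diagram_of_perm_in_half_grid_diagrams half_grid_diagram_is_diagram_of_perm by blast
  then show ?thesis
    using inj_on_diagram_of_perm by (simp add: bij_betw_def sym_group_def)
qed

theorem theorem1p16:
  fixes n :: nat
  assumes "n \<ge> 1"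
  shows "\<exists>f. bij_betw f (half_grid_diagrams n) (carrier (sym_group (2 * n)))"
  using bij_betw_inv_into[OF bij_betw_diagram_of_perm] by blast

end
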